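(* For every $n \geq 2$, the complete graph $K_n$ admits a $2$-labelling $\ell$ such that, writing $S_x = \{v : \rho_\ell(v) = x\}$, there is exactly one value $x$ for which $K_n[S_x]$ consists of a single edge (i.e., $|S_x| = 2$), while $S_y$ is an independent set (i.e., $|S_y| \leq 1$) for every other $y$.
   Context: A $2$-labelling of a graph $G$ is a map $\ell: E(G) \to \{1,2\}$. For a vertex $v$, $\rho_\ell(v)$ denotes the product of the labels $\ell(uv)$ over all edges $uv$ incident to $v$. *)

theory Defs
  imports Complex_Main "HOL-Library.FuncSet"
begin

text \<open>A graph is a pair of a vertex set and an edge set; the edges of a simple graph are
  two-element sets of vertices.\<close>

type_synonym 'a graph = "'a set \<times> 'a set set"

abbreviation verts :: "'a graph \<Rightarrow> 'a set" where
  "verts G \<equiv> fst G"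

abbreviation edges :: "'a graph \<Rightarrow> 'a set set" where
  "edges G \<equiv> snd G"

definition simple_graph :: "'a graph \<Rightarrow> bool" where
  "simple_graph G \<longleftrightarrow> finite (verts G) \<and> (\<forall>e\<in>edges G. e \<subseteq> verts G \<and> card e = 2)"

definition complete_graph :: "nat \<Rightarrow> nat graph" where
  "complete_graph n = ({..<n}, {e. e \<subseteq> {..<n} \<and> card e = 2})"

lemma simple_graph_complete_graph: "simple_graph (complete_graph n)"
  by (simp add: simple_graph_def complete_graph_def)

definition induced_subgraph :: "'a graph \<Rightarrow> 'a set \<Rightarrow> 'a graph" where
  "induced_subgraph G S = (verts G \<inter> S, {e \<in> edges G. e \<subseteq> S})"

definition single_edge :: "'a graph \<Rightarrow> bool" where
  "single_edge G \<longleftrightarrow> (\<exists>u v. u \<noteq> v \<and> G = ({u, v}, {{u, v}}))"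

definition independent_set :: "'a graph \<Rightarrow> 'a set \<Rightarrow> bool" where
  "independent_set G S \<longleftrightarrow> S \<subseteq> verts G \<and> (\<forall>u\<in>S. \<forall>v\<in>S. {u, v} \<notin> edges G)"

text \<open>A labelling is a total function of which only the values on edges matter.\<close>

definition two_labelling :: "'a graph \<Rightarrow> ('a set \<Rightarrow> nat) \<Rightarrow> bool" where
  "two_labelling G l \<longleftrightarrow> l \<in> edges G \<rightarrow> {1, 2}"

definition label_product :: "'a graph \<Rightarrow> ('a set \<Rightarrow> nat) \<Rightarrow> 'a \<Rightarrow> nat" where
  "label_product G l v = (\<Prod>e\<in>{e \<in> edges G. v \<in> e}. l e)"

definition product_class :: "'a graph \<Rightarrow> ('a set \<Rightarrow> nat) \<Rightarrow> nat \<Rightarrow> 'a set" where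
  "product_class G l x = {v \<in> verts G. label_product G l v = x}"

end

theory Submission
  imports Defs
begin

text \<open>Label the edge \<open>{v, w}\<close> by 2 exactly when \<open>v + w \<ge> n - 1\<close>. The number of edges labelled 2
  at \<open>v\<close> is then \<open>v + 1\<close>, less one if \<open>v\<close> would be counted as its own neighbour, that is, if
  \<open>2 v \<ge> n - 1\<close>. So these numbers increase strictly with \<open>v\<close>, except for one repetition of the
  value \<open>n div 2\<close> at \<open>n div 2 - 1\<close> and \<open>n div 2\<close>.\<close>

lemma label_product_complete_graph:
  assumes "v < n"
  shows "label_product (complete_graph n) l v = (\<Prod>w\<in>{..<n} - {v}. l {v, w})"
proof -
  have "{e \<in> edges (complete_graph n). v \<in> e} = (\<lambda>w. {v, w}) ` ({..<n} - {v})"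
    using assms by (auto simp: complete_graph_def card_2_iff)
  moreover have "inj_on (\<lambda>w. {v, w}) ({..<n} - {v})"
    by (auto simp: inj_on_def doubleton_eq_iff)
  ultimately show ?thesis
    by (simp add: label_product_def prod.reindex)
qed

text \<open>On an edge, \<open>\<Sum>e\<close> adds its two endpoints; adding 1 on the right avoids
  truncated subtraction.\<close>

definition half_labelling :: "nat \<Rightarrow> nat set \<Rightarrow> nat" where
  "half_labelling n e = (if n \<le> \<Sum>e + 1 then 2 else 1)"

definition half_degree :: "nat \<Rightarrow> nat \<Rightarrow> nat" where
  "half_degree n v = (if n \<le> 2 * v + 1 then v else v + 1)"

lemma label_product_half_labelling:
  assumes "v < n"
  shows "label_product (complete_graph n) (half_labelling n) v = 2 ^ half_degree n v"
proof -
  have "label_product (complete_graph n) (half_labelling n) v =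
      (\<Prod>w\<in>{..<n} - {v}. if n \<le> v + w + 1 then 2 else 1)"
    unfolding label_product_complete_graph[OF assms]
    by (intro prod.cong) (auto simp: half_labelling_def)
  also have "\<dots> = (\<Prod>w\<in>({..<n} - {v}) \<inter> {w. n \<le> v + w + 1}. 2)"
    by (simp add: prod.If_cases)
  also have "({..<n} - {v}) \<inter> {w. n \<le> v + w + 1} = {n - 1 - v..<n} - {v}"
    by auto
  \<comment> \<open>As \<open>v < n\<close>, the interval has \<open>v + 1\<close> elements, and
    \<open>v\<close> is one of them iff \<open>n \<le> 2 * v + 1\<close>.\<close>
  also have "card ({n - 1 - v..<n} - {v}) = half_degree n v"
    using assms by (auto simp: half_degree_def card_Diff_singleton_if)
  then have "(\<Prod>w\<in>{n - 1 - v..<n} - {v}. 2) = (2 :: nat) ^ half_degree n v"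
    by simp
  finally show ?thesis .
qed

text \<open>Each branch of \<open>half_degree\<close> is injective, so a collision pairs some
  \<open>v\<close> below the threshold with \<open>v + 1\<close> above it. Then
  \<open>2 * v + 1 < n \<le> 2 * v + 3\<close>, which forces \<open>n div 2 = v + 1\<close>.\<close>

lemma half_degree_eq_imp:
  assumes "half_degree n u = half_degree n v" "u \<noteq> v"
  shows "half_degree n u = n div 2"
  using assms by (auto simp: half_degree_def split: if_splits)

lemma half_degree_eq_half_iff:
  assumes "n \<ge> 2"
  shows "half_degree n v = n div 2 \<longleftrightarrow> v = n div 2 - 1 \<or> v = n div 2"
  using assms by (auto simp: half_degree_def)

theorem theorem4p2:
  fixes n :: nat
  assumes "n \<ge> 2"
  shows "\<exists>l. two_labelling (complete_graph n) l \<and>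
    (\<exists>x. (\<forall>z. single_edge (induced_subgraph (complete_graph n)
                      (product_class (complete_graph n) l z)) \<longleftrightarrow> z = x) \<and>
         (\<forall>y. y \<noteq> x \<longrightarrow> independent_set (complete_graph n)
                      (product_class (complete_graph n) l y)))"
proof -
  let ?K = "complete_graph n" and ?x = "2 ^ (n div 2) :: nat"
  let ?S = "product_class ?K (half_labelling n)"
  have S: "?S z = {v. v < n \<and> 2 ^ half_degree n v = z}" for z
    using label_product_half_labelling[of _ n]
    unfolding product_class_def complete_graph_def fst_conv lessThan_iff by metis
  \<comment> \<open>Powers of 2 are injective in the exponent, so equal products mean equal half
    degrees.\<close>
  have unique: "z = ?x" if "u \<in> ?S z" "v \<in> ?S z" "u \<noteq> v" for u v z
    using that half_degree_eq_imp[of n u v] by (auto simp: S)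
  have "?S ?x = {n div 2 - 1, n div 2}"
    using assms by (auto simp: S half_degree_eq_half_iff)
  moreover have "n div 2 - 1 \<noteq> n div 2"
    using assms by auto
  ultimately obtain a b where ab: "?S ?x = {a, b}" "a \<noteq> b"
    by blast
  then have "a < n" "b < n"
    using S[of ?x] by blast+
  moreover have "e = {a, b}" if "e \<subseteq> {a, b}" "card e = 2" for e
    using card_subset_eq[of "{a, b}" e] that \<open>a \<noteq> b\<close> by simp
  ultimately have "induced_subgraph ?K {a, b} = ({a, b}, {{a, b}})"
    using \<open>a \<noteq> b\<close> by (auto simp: induced_subgraph_def complete_graph_def)
  then have single: "single_edge (induced_subgraph ?K (?S ?x))"
    unfolding ab(1) single_edge_def using ab(2) by blast
  have "z = ?x" if "single_edge (induced_subgraph ?K (?S z))" for z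
  proof -
    obtain u v where "u \<noteq> v" "induced_subgraph ?K (?S z) = ({u, v}, {{u, v}})"
      using \<open>single_edge (induced_subgraph ?K (?S z))\<close> unfolding single_edge_def by blast
    then have "u \<noteq> v" "u \<in> ?S z" "v \<in> ?S z"
      unfolding induced_subgraph_def by blast+
    then show ?thesis
      by (intro unique)
  qed
  moreover have "independent_set ?K (?S y)" if "y \<noteq> ?x" for y
    unfolding independent_set_def
  proof (intro conjI ballI)
    fix u v
    assume "u \<in> ?S y" "v \<in> ?S y"
    with that unique have "u = v"
      by blast
    \<comment> \<open>With \<open>u = v\<close> the set is a singleton, whereas edges have two
      elements.\<close>
    then show "{u, v} \<notin> edges ?K"
      by (simp add: complete_graph_def)
  qed (auto simp: product_class_def)
  moreover have "two_labelling ?K (half_labelling n)"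
    by (auto simp: two_labelling_def half_labelling_def)
  ultimately show ?thesis
    using single by blast
qed

end
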